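(* For every $\delta\ge \tfrac12$, no deterministic online algorithm for the Online Simple Knapsack problem with item size estimates and additive estimate accuracy $\delta$ has a constant (finite) competitive ratio.
   Context: Online Simple Knapsack with Item Size Estimates (additive accuracy $\delta\ge 0$): an instance consists of actual item sizes $x_1,\dots,x_n\in[0,1]$ together with estimated sizes $x_1',\dots,x_n'$ satisfying $x_i'-\delta\le x_i\le x_i'+\delta$ for all $i$. A deterministic online algorithm knows $\delta$ and the whole list of estimates from the start. The actual sizes are then revealed one at a time in order. When $x_i$ is revealed, the algorithm must irrevocably either pack it into an initially empty knapsack of capacity $1$ (allowed only if the total size already packed plus $x_i$ is at most $1$) or reject it. The gain of an algorithm is the total size of the packed items; $\mathrm{OPT}$ is the maximum total size of a subset of the actual items with total at most $1$. The competitive ratio of an algorithm $A$ is $\sup \mathrm{OPT}/\mathrm{gain}_A$ over all instances with accuracy $\delta$ (a ratio with positive $\mathrm{OPT}$ and zero gain counts as $\infty$). *)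

theory Defs
  imports "HOL-Library.Extended_Real"
begin

text \<open>
  An instance is a pair of lists: the estimated sizes and the actual sizes, with indices
  counted from 0. Only the actual sizes are required to lie in the unit interval.
\<close>

definition knapsack_instance :: "real \<Rightarrow> real list \<Rightarrow> real list \<Rightarrow> bool" where
  "knapsack_instance \<delta> est act \<longleftrightarrow>
     length est = length act \<and>
     (\<forall>i < length act. 0 \<le> act ! i \<and> act ! i \<le> 1 \<and>
        est ! i - \<delta> \<le> act ! i \<and> act ! i \<le> est ! i + \<delta>)"

text \<open>
  A deterministic algorithm maps the list of all estimates and the nonempty list of actual sizes
  revealed so far (the last entry being the current item) to its decision on the current item:
  \<^term>\<open>True\<close> for packing, \<^term>\<open>False\<close> for rejecting. Its own earlier decisions are functions
  of the same data, so they need not be passed as an argument. The accuracy \<open>\<delta>\<close> is no argument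
  either: it is fixed before the algorithm is chosen.
\<close>

type_synonym online_alg = "real list \<Rightarrow> real list \<Rightarrow> bool"

definition packs :: "online_alg \<Rightarrow> real list \<Rightarrow> real list \<Rightarrow> nat \<Rightarrow> bool" where
  "packs A est act i \<longleftrightarrow> A est (take (Suc i) act)"

definition packed_size :: "online_alg \<Rightarrow> real list \<Rightarrow> real list \<Rightarrow> nat \<Rightarrow> real" where
  "packed_size A est act i = (\<Sum>j | j < i \<and> packs A est act j. act ! j)"

definition online_algorithm :: "real \<Rightarrow> online_alg \<Rightarrow> bool" where
  "online_algorithm \<delta> A \<longleftrightarrow>
     (\<forall>est act. knapsack_instance \<delta> est act \<longrightarrow>
        (\<forall>i < length act. packs A est act i \<longrightarrow> packed_size A est act i + act ! i \<le> 1))"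

definition gain :: "online_alg \<Rightarrow> real list \<Rightarrow> real list \<Rightarrow> real" where
  "gain A est act = packed_size A est act (length act)"

definition opt :: "real list \<Rightarrow> real" where
  "opt act = Max {(\<Sum>i\<in>S. act ! i) | S. S \<subseteq> {..<length act} \<and> (\<Sum>i\<in>S. act ! i) \<le> 1}"

text \<open>
  The case of a vanishing optimum (where the gain vanishes too) counts as ratio 1.
\<close>

definition performance_ratio :: "online_alg \<Rightarrow> real list \<Rightarrow> real list \<Rightarrow> ereal" where
  "performance_ratio A est act =
     (if opt act = 0 then 1
      else if gain A est act = 0 then \<infinity>
      else ereal (opt act / gain A est act))"

definition competitive_ratio :: "real \<Rightarrow> online_alg \<Rightarrow> ereal" where
  "competitive_ratio \<delta> A =
     (SUP (est, act) \<in> {(est, act). knapsack_instance \<delta> est act}. performance_ratio A est act)"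

end

theory Submission
  imports Defs
begin

text \<open>
  With \<open>\<delta> \<ge> 1/2\<close> the estimates \<open>1/2, 1/2\<close> carry no information. Reveal a tiny first item
  \<open>\<epsilon>\<close>. If the algorithm rejects it, the second item is \<open>0\<close> and nothing is gained; if the
  algorithm packs it, the second item is \<open>1\<close>, which no longer fits, and the ratio is at least
  \<open>1/\<epsilon>\<close>. Both continuations look the same when the first decision is made.
\<close>

lemma packed_size_0 [simp]: "packed_size A est act 0 = 0"
  by (simp add: packed_size_def)

lemma packed_size_Suc [simp]:
  "packed_size A est act (Suc i) =
     packed_size A est act i + (if packs A est act i then act ! i else 0)"
proof -
  have "{j. j < Suc i \<and> packs A est act j} =
      (if packs A est act i then insert i {j. j < i \<and> packs A est act j}
       else {j. j < i \<and> packs A est act j})"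
    by (auto simp: less_Suc_eq)
  then show ?thesis
    by (simp add: packed_size_def)
qed

text \<open>\<open>Max\<close> bounds its elements only on a finite set; here the sums are images of
  the finitely many index sets.\<close>

lemma sum_le_opt:
  assumes "S \<subseteq> {..<length act}" "(\<Sum>i\<in>S. act ! i) \<le> 1"
  shows "(\<Sum>i\<in>S. act ! i) \<le> opt act"
proof -
  let ?sums = "{(\<Sum>i\<in>S. act ! i) | S. S \<subseteq> {..<length act} \<and> (\<Sum>i\<in>S. act ! i) \<le> 1}"
  have "?sums \<subseteq> (\<lambda>S. \<Sum>i\<in>S. act ! i) ` Pow {..<length act}"
    by auto
  then have "finite ?sums"
    by (rule finite_subset) simp
  then show ?thesis
    unfolding opt_def using assms by (intro Max_ge) auto
qed

lemma nth_le_opt: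
  assumes "i < length act" "act ! i \<le> 1"
  shows "act ! i \<le> opt act"
  using sum_le_opt[of "{i}" act] assms by simp

lemma performance_ratio_le_competitive_ratio:
  assumes "knapsack_instance \<delta> est act"
  shows "performance_ratio A est act \<le> competitive_ratio \<delta> A"
proof -
  \<comment> \<open>The \<open>case\<close> form matches the pair abstraction under the
    \<open>SUP\<close>.\<close>
  have "(case (est, act) of (est, act) \<Rightarrow> performance_ratio A est act) \<le> competitive_ratio \<delta> A"
    unfolding competitive_ratio_def by (rule SUP_upper) (use assms in simp)
  then show ?thesis by simp
qed

text \<open>Stated for every small \<epsilon> because, if the first item is packed, one instance
  gives only a finite bound.\<close>

lemma competitive_ratio_ge_inverse:
  assumes \<delta>: "\<delta> \<ge> 1 / 2" and A: "online_algorithm \<delta> A" and \<epsilon>: "0 < \<epsilon>" "\<epsilon> \<le> 1"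
  shows "ereal (1 / \<epsilon>) \<le> competitive_ratio \<delta> A"
proof -
  let ?est = "[1 / 2, 1 / 2] :: real list"
  \<comment> \<open>As \<delta> \<ge> 1/2, the interval of radius \<delta> around 1/2 covers the
    whole unit interval.\<close>
  have inst: "knapsack_instance \<delta> ?est [\<epsilon>, x]" if "0 \<le> x" "x \<le> 1" for x
    using \<delta> \<epsilon> that by (auto simp: knapsack_instance_def less_Suc_eq)
  \<comment> \<open>The prefix seen at index 0 does not contain \<open>x\<close>.\<close>
  have first: "packs A ?est [\<epsilon>, x] 0 \<longleftrightarrow> A ?est [\<epsilon>]" for x
    by (simp add: packs_def)
  show ?thesis
  proof (cases "A ?est [\<epsilon>]")
    case True
    \<comment> \<open>Packing both items would give total size \<epsilon> + 1 > 1.\<close>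
    have "\<not> packs A ?est [\<epsilon>, 1] 1"
    proof
      assume "packs A ?est [\<epsilon>, 1] 1"
      with A inst[of 1] have "packed_size A ?est [\<epsilon>, 1] 1 + [\<epsilon>, 1] ! 1 \<le> 1"
        unfolding online_algorithm_def by fastforce
      with True \<epsilon> show False by (simp add: first)
    qed
    with True have gain: "gain A ?est [\<epsilon>, 1] = \<epsilon>"
      by (simp add: gain_def first)
    have "1 \<le> opt [\<epsilon>, 1]"
      using nth_le_opt[of 1 "[\<epsilon>, 1]"] by simp
    with gain \<epsilon> have "ereal (1 / \<epsilon>) \<le> performance_ratio A ?est [\<epsilon>, 1]"
      by (simp add: performance_ratio_def divide_right_mono)
    also have "\<dots> \<le> competitive_ratio \<delta> A"
      by (intro performance_ratio_le_competitive_ratio inst) auto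
    finally show ?thesis .
  next
    case False
    then have gain: "gain A ?est [\<epsilon>, 0] = 0"
      by (simp add: gain_def first)
    \<comment> \<open>A positive optimum rules out the default ratio 1.\<close>
    have "\<epsilon> \<le> opt [\<epsilon>, 0]"
      using nth_le_opt[of 0 "[\<epsilon>, 0]"] \<epsilon> by simp
    with gain \<epsilon> have "performance_ratio A ?est [\<epsilon>, 0] = \<infinity>"
      by (simp add: performance_ratio_def)
    moreover have "performance_ratio A ?est [\<epsilon>, 0] \<le> competitive_ratio \<delta> A"
      by (intro performance_ratio_le_competitive_ratio inst) auto
    ultimately show ?thesis by simp
  qed
qed

theorem theorem7:
  fixes \<delta> :: real
  assumes "\<delta> \<ge> 1 / 2"
  shows "\<not> (\<exists>A. online_algorithm \<delta> A \<and> competitive_ratio \<delta> A < \<infinity>)"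
proof
  assume "\<exists>A. online_algorithm \<delta> A \<and> competitive_ratio \<delta> A < \<infinity>"
  then obtain A where A: "online_algorithm \<delta> A" and "competitive_ratio \<delta> A < \<infinity>"
    by blast
  then obtain n :: nat where n: "competitive_ratio \<delta> A < ereal (real n)"
    using less_PInf_Ex_of_nat by auto
  \<comment> \<open>Take \<epsilon> = 1/(n + 1); the successor keeps \<epsilon> positive and at most
    1 even for n = 0.\<close>
  have "ereal (real n) \<le> ereal (1 / (1 / real (Suc n)))"
    by simp
  also have "\<dots> \<le> competitive_ratio \<delta> A"
    by (rule competitive_ratio_ge_inverse[OF assms A]) auto
  finally show False
    using n by simp
qed

end
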